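(* Let $(J_k)_{k\in K}$ be a family of Grothendieck topologies on an essentially small category $\mathcal C$, and let $J=\bigvee_{k\in K}J_k$ be the smallest topology on $\mathcal C$ which contains all the topologies $J_k$, $k\in K$. Then a sieve $C\hookrightarrow y(X)$ on an object $X$ of $\mathcal C$ is an element of $J$ if and only if the maximal sieve is the unique sieve on $X$ satisfying the two following conditions: - it contains the sieve $C$; - it is $J_k$-closed for every $k\in K$.
   Context: A sieve $C'$ on $X$ is closed for a topology $J_k$ if a morphism $x:X'\to X$ belongs to $C'$ as soon as the sieve $x^*C'=\{x':X''\to X'\mid x\circ x'\in C'\}$ on $X'$ is $J_k$-covering. *)

theory Defs
  imports Main
begin

section \<open>Categories\<close>

record ('o, 'm) cat =
  Obj :: "'o set"
  Arr :: "'m set"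
  source :: "'m \<Rightarrow> 'o"
  target :: "'m \<Rightarrow> 'o"
  ident :: "'o \<Rightarrow> 'm"
  compose :: "'m \<Rightarrow> 'm \<Rightarrow> 'm"  (* compose \<C> g f is g after f *)

definition hom :: "('o, 'm) cat \<Rightarrow> 'o \<Rightarrow> 'o \<Rightarrow> 'm set" where
  "hom \<C> X Y = {f \<in> Arr \<C>. source \<C> f = X \<and> target \<C> f = Y}"

locale category =
  fixes \<C> :: "('o, 'm) cat"
  assumes source_in_Obj: "f \<in> Arr \<C> \<Longrightarrow> source \<C> f \<in> Obj \<C>"
    and target_in_Obj: "f \<in> Arr \<C> \<Longrightarrow> target \<C> f \<in> Obj \<C>"
    and ident_in_hom: "X \<in> Obj \<C> \<Longrightarrow> ident \<C> X \<in> hom \<C> X X"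
    and compose_in_hom:
      "f \<in> hom \<C> X Y \<Longrightarrow> g \<in> hom \<C> Y Z \<Longrightarrow> compose \<C> g f \<in> hom \<C> X Z"
    and compose_ident: "f \<in> hom \<C> X Y \<Longrightarrow> compose \<C> f (ident \<C> X) = f"
    and ident_compose: "f \<in> hom \<C> X Y \<Longrightarrow> compose \<C> (ident \<C> Y) f = f"
    and compose_assoc:
      "f \<in> hom \<C> W X \<Longrightarrow> g \<in> hom \<C> X Y \<Longrightarrow> h \<in> hom \<C> Y Z \<Longrightarrow>
        compose \<C> h (compose \<C> g f) = compose \<C> (compose \<C> h g) f"

section \<open>Equivalence of categories and essential smallness\<close>

record ('o, 'm, 'p, 'n) ftor =
  on_obj :: "'o \<Rightarrow> 'p"
  on_arr :: "'m \<Rightarrow> 'n"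

definition is_functor ::
    "('o, 'm) cat \<Rightarrow> ('p, 'n) cat \<Rightarrow> ('o, 'm, 'p, 'n) ftor \<Rightarrow> bool" where
  "is_functor \<C> \<D> F \<longleftrightarrow>
     (\<forall>X\<in>Obj \<C>. on_obj F X \<in> Obj \<D>) \<and>
     (\<forall>X Y. \<forall>f\<in>hom \<C> X Y. on_arr F f \<in> hom \<D> (on_obj F X) (on_obj F Y)) \<and>
     (\<forall>X\<in>Obj \<C>. on_arr F (ident \<C> X) = ident \<D> (on_obj F X)) \<and>
     (\<forall>X Y Z. \<forall>f\<in>hom \<C> X Y. \<forall>g\<in>hom \<C> Y Z.
        on_arr F (compose \<C> g f) = compose \<D> (on_arr F g) (on_arr F f))"

definition id_ftor :: "('o, 'm, 'o, 'm) ftor" where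
  "id_ftor = \<lparr>on_obj = id, on_arr = id\<rparr>"

definition comp_ftor ::
    "('p, 'n, 'q, 'l) ftor \<Rightarrow> ('o, 'm, 'p, 'n) ftor \<Rightarrow> ('o, 'm, 'q, 'l) ftor" where
  "comp_ftor G F = \<lparr>on_obj = on_obj G \<circ> on_obj F, on_arr = on_arr G \<circ> on_arr F\<rparr>"

definition is_iso :: "('o, 'm) cat \<Rightarrow> 'o \<Rightarrow> 'o \<Rightarrow> 'm \<Rightarrow> bool" where
  "is_iso \<C> X Y f \<longleftrightarrow> f \<in> hom \<C> X Y \<and>
     (\<exists>g\<in>hom \<C> Y X. compose \<C> g f = ident \<C> X \<and> compose \<C> f g = ident \<C> Y)"

definition natural_iso ::
    "('o, 'm) cat \<Rightarrow> ('p, 'n) cat \<Rightarrow> ('o, 'm, 'p, 'n) ftor \<Rightarrow> ('o, 'm, 'p, 'n) ftor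
      \<Rightarrow> ('o \<Rightarrow> 'n) \<Rightarrow> bool" where
  "natural_iso \<C> \<D> F G \<eta> \<longleftrightarrow>
     (\<forall>X\<in>Obj \<C>. is_iso \<D> (on_obj F X) (on_obj G X) (\<eta> X)) \<and>
     (\<forall>X Y. \<forall>f\<in>hom \<C> X Y.
        compose \<D> (\<eta> Y) (on_arr F f) = compose \<D> (on_arr G f) (\<eta> X))"

definition equivalent_categories :: "('o, 'm) cat \<Rightarrow> ('p, 'n) cat \<Rightarrow> bool" where
  "equivalent_categories \<C> \<D> \<longleftrightarrow>
     (\<exists>F G \<eta> \<epsilon>. is_functor \<C> \<D> F \<and> is_functor \<D> \<C> G \<and>
        natural_iso \<C> \<C> id_ftor (comp_ftor G F) \<eta> \<and>
        natural_iso \<D> \<D> (comp_ftor F G) id_ftor \<epsilon>)"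

text \<open>HOL has no built-in distinction between sets and proper classes.  Smallness is therefore
  relative to a type \<open>'u\<close> playing the role of the universe of small things: a small category
  is one whose objects and arrows are elements of \<open>'u\<close>.  Since \<open>'u\<close> is arbitrary, so
  is the size of the categories covered.\<close>

definition essentially_small :: "'u itself \<Rightarrow> ('o, 'm) cat \<Rightarrow> bool" where
  "essentially_small _ \<C> \<longleftrightarrow>
     (\<exists>\<S> :: ('u, 'u) cat. category \<S> \<and> equivalent_categories \<C> \<S>)"

section \<open>Sieves and Grothendieck topologies\<close>

text \<open>A subobject of the representable presheaf \<open>y(X)\<close> is given by the set of arrows with
  target \<open>X\<close> that it contains.\<close>

definition is_sieve :: "('o, 'm) cat \<Rightarrow> 'o \<Rightarrow> 'm set \<Rightarrow> bool" where
  "is_sieve \<C> X S \<longleftrightarrow>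
     S \<subseteq> {x \<in> Arr \<C>. target \<C> x = X} \<and>
     (\<forall>x\<in>S. \<forall>x'\<in>Arr \<C>. target \<C> x' = source \<C> x \<longrightarrow> compose \<C> x x' \<in> S)"

definition maximal_sieve :: "('o, 'm) cat \<Rightarrow> 'o \<Rightarrow> 'm set" where
  "maximal_sieve \<C> X = {x \<in> Arr \<C>. target \<C> x = X}"

definition pullback_sieve :: "('o, 'm) cat \<Rightarrow> 'm \<Rightarrow> 'm set \<Rightarrow> 'm set" where
  "pullback_sieve \<C> x S =
     {x' \<in> Arr \<C>. target \<C> x' = source \<C> x \<and> compose \<C> x x' \<in> S}"

text \<open>A topology is the set of its covering sieves, each tagged with the object it lives on
  (the empty sieve does not determine its object).  The three conditions after the first are
  maximality, stability and transitivity.\<close>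

definition grothendieck_topology :: "('o, 'm) cat \<Rightarrow> ('o \<times> 'm set) set \<Rightarrow> bool" where
  "grothendieck_topology \<C> J \<longleftrightarrow>
     (\<forall>(X, S)\<in>J. X \<in> Obj \<C> \<and> is_sieve \<C> X S) \<and>
     (\<forall>X\<in>Obj \<C>. (X, maximal_sieve \<C> X) \<in> J) \<and>
     (\<forall>X S. (X, S) \<in> J \<longrightarrow>
        (\<forall>Y. \<forall>x\<in>hom \<C> Y X. (Y, pullback_sieve \<C> x S) \<in> J)) \<and>
     (\<forall>X S R. (X, S) \<in> J \<and> is_sieve \<C> X R \<and>
        (\<forall>x\<in>S. (source \<C> x, pullback_sieve \<C> x R) \<in> J) \<longrightarrow> (X, R) \<in> J)"

definition join_topology ::
    "('o, 'm) cat \<Rightarrow> 'k set \<Rightarrow> ('k \<Rightarrow> ('o \<times> 'm set) set) \<Rightarrow> ('o \<times> 'm set) set" where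
  "join_topology \<C> K J = (LEAST T. grothendieck_topology \<C> T \<and> (\<forall>k\<in>K. J k \<subseteq> T))"

definition closed_sieve ::
    "('o, 'm) cat \<Rightarrow> ('o \<times> 'm set) set \<Rightarrow> 'o \<Rightarrow> 'm set \<Rightarrow> bool" where
  "closed_sieve \<C> J X S \<longleftrightarrow>
     (\<forall>X'. \<forall>x\<in>hom \<C> X' X. (X', pullback_sieve \<C> x S) \<in> J \<longrightarrow> x \<in> S)"

section \<open>The join exists\<close>

lemma pullback_is_sieve:
  assumes "category \<C>" "is_sieve \<C> X S" "x \<in> hom \<C> Y X"
  shows "is_sieve \<C> Y (pullback_sieve \<C> x S)"
proof -
  interpret category \<C> by fact
  have "compose \<C> x' x'' \<in> pullback_sieve \<C> x S"
    if x': "x' \<in> pullback_sieve \<C> x S" and x'': "x'' \<in> Arr \<C>" "target \<C> x'' = source \<C> x'"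
    for x' x''
  proof -
    have h1: "x' \<in> hom \<C> (source \<C> x') Y" and h2: "x'' \<in> hom \<C> (source \<C> x'') (source \<C> x')"
      using x' x'' assms(3) by (auto simp: pullback_sieve_def hom_def)
    have c: "compose \<C> x' x'' \<in> hom \<C> (source \<C> x'') Y"
      by (rule compose_in_hom[OF h2 h1])
    have "source \<C> (compose \<C> x x') = source \<C> x'"
      using compose_in_hom[OF h1 assms(3)] by (simp add: hom_def)
    then have "compose \<C> (compose \<C> x x') x'' \<in> S"
      using assms(2) x' x'' by (auto simp: is_sieve_def pullback_sieve_def)
    then show ?thesis
      using c compose_assoc[OF h2 h1 assms(3)] assms(3)
      by (auto simp: pullback_sieve_def hom_def)
  qed
  then show ?thesis
    using assms(3) by (auto simp: is_sieve_def pullback_sieve_def hom_def)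
qed

lemma maximal_is_sieve:
  assumes "category \<C>"
  shows "is_sieve \<C> X (maximal_sieve \<C> X)"
proof -
  interpret category \<C> by fact
  have "compose \<C> x x' \<in> maximal_sieve \<C> X"
    if "x \<in> maximal_sieve \<C> X" "x' \<in> Arr \<C>" "target \<C> x' = source \<C> x" for x x'
    using that compose_in_hom[of x' "source \<C> x'" "source \<C> x" x X]
    by (auto simp: maximal_sieve_def hom_def)
  then show ?thesis by (auto simp: is_sieve_def maximal_sieve_def)
qed

lemma discrete_topology:
  assumes "category \<C>"
  shows "grothendieck_topology \<C> {(X, S). X \<in> Obj \<C> \<and> is_sieve \<C> X S}"
proof -
  interpret category \<C> by fact
  have "Y \<in> Obj \<C>" if "x \<in> hom \<C> Y X" for x X Y
    using that source_in_Obj by (auto simp: hom_def)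
  then show ?thesis
    using pullback_is_sieve[OF assms] maximal_is_sieve[OF assms]
    unfolding grothendieck_topology_def by blast
qed

lemma Inter_topology:
  assumes "\<T> \<noteq> {}" "\<And>T. T \<in> \<T> \<Longrightarrow> grothendieck_topology \<C> T"
  shows "grothendieck_topology \<C> (\<Inter>\<T>)"
  unfolding grothendieck_topology_def
proof (intro conjI allI impI ballI)
  fix p assume "p \<in> \<Inter>\<T>"
  then show "case p of (X, S) \<Rightarrow> X \<in> Obj \<C> \<and> is_sieve \<C> X S"
    using assms unfolding grothendieck_topology_def by blast
next
  fix X assume "X \<in> Obj \<C>"
  then show "(X, maximal_sieve \<C> X) \<in> \<Inter>\<T>"
    using assms(2) unfolding grothendieck_topology_def by blast
next
  fix X S Y x assume "(X, S) \<in> \<Inter>\<T>" "x \<in> hom \<C> Y X"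
  then show "(Y, pullback_sieve \<C> x S) \<in> \<Inter>\<T>"
    using assms(2) unfolding grothendieck_topology_def by blast
next
  fix X S R
  assume *: "(X, S) \<in> \<Inter>\<T> \<and> is_sieve \<C> X R \<and>
    (\<forall>x\<in>S. (source \<C> x, pullback_sieve \<C> x R) \<in> \<Inter>\<T>)"
  show "(X, R) \<in> \<Inter>\<T>"
  proof
    fix T assume T: "T \<in> \<T>"
    then have "(X, S) \<in> T" "is_sieve \<C> X R"
      "\<forall>x\<in>S. (source \<C> x, pullback_sieve \<C> x R) \<in> T"
      using * by auto
    then show "(X, R) \<in> T"
      using assms(2)[OF T] unfolding grothendieck_topology_def by blast
  qed
qed

lemma join_topology_least:
  assumes "category \<C>" "\<And>k. k \<in> K \<Longrightarrow> grothendieck_topology \<C> (J k)"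
  shows "grothendieck_topology \<C> (join_topology \<C> K J)"
    and "k \<in> K \<Longrightarrow> J k \<subseteq> join_topology \<C> K J"
    and "grothendieck_topology \<C> T \<Longrightarrow> (\<And>k. k \<in> K \<Longrightarrow> J k \<subseteq> T) \<Longrightarrow>
      join_topology \<C> K J \<subseteq> T"
proof -
  let ?P = "\<lambda>T. grothendieck_topology \<C> T \<and> (\<forall>k\<in>K. J k \<subseteq> T)"
  let ?D = "{(X, S). X \<in> Obj \<C> \<and> is_sieve \<C> X S}"
  have "J k \<subseteq> ?D" if "k \<in> K" for k
    using assms(2)[OF that] unfolding grothendieck_topology_def by blast
  then have "?P ?D"
    using discrete_topology[OF assms(1)] by blast
  then have ne: "Collect ?P \<noteq> {}" by blast
  have top: "grothendieck_topology \<C> (\<Inter>(Collect ?P))"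
    by (rule Inter_topology[OF ne]) blast
  have P: "?P (\<Inter>(Collect ?P))"
    using top by blast
  have eq: "join_topology \<C> K J = \<Inter>(Collect ?P)"
    unfolding join_topology_def by (rule Least_equality[where P = ?P]) (use P in blast)+
  show "grothendieck_topology \<C> (join_topology \<C> K J)"
    and "k \<in> K \<Longrightarrow> J k \<subseteq> join_topology \<C> K J"
    and "grothendieck_topology \<C> T \<Longrightarrow> (\<And>k. k \<in> K \<Longrightarrow> J k \<subseteq> T) \<Longrightarrow>
      join_topology \<C> K J \<subseteq> T"
    unfolding eq using P by blast+
qed

end

theory Submission
  imports Defs
begin

text \<open>Call a sieve \<open>S\<close> on \<open>X\<close> \<^emph>\<open>dense\<close> for the family \<open>J\<close> if no sieve on \<open>X\<close> other than the
  maximal one contains \<open>S\<close> and is closed for every \<open>J k\<close>; the claim is that the dense sieves are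
  exactly the covering sieves of the join.

  Covering sieves of the join are dense because the dense sieves form a topology
  (\<open>dense_topology\<close>) that contains every \<open>J k\<close>.  The one axiom that is not formal is stability: to
  test whether \<open>x\<^sup>*S\<close> is dense against a closed sieve \<open>D\<close> on the source of \<open>x\<close>, one tests \<open>S\<close>
  against \<open>\<forall>\<^sub>x D\<close>, where \<open>\<forall>\<^sub>x\<close> is the right adjoint of \<open>x\<^sup>*\<close>.  This works because \<open>\<forall>\<^sub>x\<close> preserves
  closedness (\<open>forall_sieve_closed\<close>).

  Conversely, let \<open>T\<close> be any topology containing every \<open>J k\<close>, for instance the join.  The
  \<open>T\<close>-closure of \<open>C\<close>, formed by all \<open>x\<close> such that \<open>x\<^sup>*C\<close> is in \<open>T\<close>, contains \<open>C\<close> and is closed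
  for \<open>T\<close>, hence for each \<open>J k\<close> (\<open>closure_sieve_closed\<close>).  If \<open>C\<close> is dense, this closure contains
  the identity of \<open>X\<close>, which says that \<open>C\<close> itself is in \<open>T\<close>.\<close>

section \<open>Topologies and pullbacks of sieves\<close>

lemma topology_sieve:
  assumes "grothendieck_topology \<C> T" "(X, S) \<in> T"
  shows "X \<in> Obj \<C>" "is_sieve \<C> X S"
  using assms unfolding grothendieck_topology_def by blast+

lemma topology_maximal:
  assumes "grothendieck_topology \<C> T" "X \<in> Obj \<C>"
  shows "(X, maximal_sieve \<C> X) \<in> T"
  using assms unfolding grothendieck_topology_def by blast

lemma topology_stable:
  assumes "grothendieck_topology \<C> T" "(X, S) \<in> T" "x \<in> hom \<C> Y X"
  shows "(Y, pullback_sieve \<C> x S) \<in> T"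
  using assms unfolding grothendieck_topology_def by blast

lemma topology_transitive:
  assumes "grothendieck_topology \<C> T" "(X, S) \<in> T" "is_sieve \<C> X R"
    and "\<And>x. x \<in> S \<Longrightarrow> (source \<C> x, pullback_sieve \<C> x R) \<in> T"
  shows "(X, R) \<in> T"
  using assms unfolding grothendieck_topology_def by blast

lemma sieve_arrow:
  assumes "is_sieve \<C> X S" "x \<in> S"
  shows "x \<in> hom \<C> (source \<C> x) X"
  using assms by (auto simp: is_sieve_def hom_def)

lemma sieve_compose:
  assumes "is_sieve \<C> X S" "x \<in> S" "x \<in> hom \<C> Y X" "y \<in> hom \<C> Z Y"
  shows "compose \<C> x y \<in> S"
  using assms by (auto simp: is_sieve_def hom_def)

lemma in_pullback:
  assumes "x \<in> hom \<C> Y X"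
  shows "y \<in> pullback_sieve \<C> x S \<longleftrightarrow> y \<in> hom \<C> (source \<C> y) Y \<and> compose \<C> x y \<in> S"
  using assms by (auto simp: pullback_sieve_def hom_def)

lemma in_maximal:
  "x \<in> maximal_sieve \<C> X \<longleftrightarrow> x \<in> hom \<C> (source \<C> x) X"
  by (auto simp: maximal_sieve_def hom_def)

context category
begin

lemma hom_Obj:
  assumes "x \<in> hom \<C> Y X"
  shows "Y \<in> Obj \<C>" "X \<in> Obj \<C>"
  using assms source_in_Obj target_in_Obj by (auto simp: hom_def)

lemma category_self: "category \<C>"
  by unfold_locales

lemma pullback_ident:
  assumes "is_sieve \<C> X S" "X \<in> Obj \<C>"
  shows "pullback_sieve \<C> (ident \<C> X) S = S"
  using sieve_arrow[OF assms(1)] ident_compose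
  by (fastforce simp: in_pullback[OF ident_in_hom[OF assms(2)]])

lemma pullback_compose:
  assumes "x \<in> hom \<C> Y X" "y \<in> hom \<C> Z Y"
  shows "pullback_sieve \<C> (compose \<C> x y) S = pullback_sieve \<C> y (pullback_sieve \<C> x S)"
proof -
  have "z \<in> pullback_sieve \<C> (compose \<C> x y) S \<longleftrightarrow>
      z \<in> pullback_sieve \<C> y (pullback_sieve \<C> x S)" for z
  proof (cases "z \<in> hom \<C> (source \<C> z) Z")
    case True
    have yz: "compose \<C> y z \<in> hom \<C> (source \<C> z) Y"
      by (rule compose_in_hom[OF True assms(2)])
    then have "source \<C> (compose \<C> y z) = source \<C> z"
      by (simp add: hom_def)
    then show ?thesis
      using True yz compose_assoc[OF True assms(2,1)]
      by (simp add: in_pullback[OF compose_in_hom[OF assms(2,1)]] in_pullback[OF assms(1)]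
          in_pullback[OF assms(2)])
  next
    case False
    then show ?thesis
      by (simp add: in_pullback[OF compose_in_hom[OF assms(2,1)]] in_pullback[OF assms(2)])
  qed
  then show ?thesis by blast
qed

lemma sieve_maximal_iff:
  assumes "is_sieve \<C> X S" "X \<in> Obj \<C>"
  shows "S = maximal_sieve \<C> X \<longleftrightarrow> ident \<C> X \<in> S"
proof
  assume "S = maximal_sieve \<C> X"
  then show "ident \<C> X \<in> S"
    using ident_in_hom[OF assms(2)] by (auto simp: maximal_sieve_def hom_def)
next
  assume id: "ident \<C> X \<in> S"
  have "x \<in> S" if "x \<in> maximal_sieve \<C> X" for x
    using sieve_compose[OF assms(1) id ident_in_hom[OF assms(2)]] ident_compose that
    unfolding in_maximal by metis
  moreover have "x \<in> maximal_sieve \<C> X" if "x \<in> S" for x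
    using sieve_arrow[OF assms(1) that] unfolding in_maximal .
  ultimately show "S = maximal_sieve \<C> X" by blast
qed

lemma pullback_maximal_iff:
  assumes "is_sieve \<C> X S" "x \<in> hom \<C> Y X"
  shows "pullback_sieve \<C> x S = maximal_sieve \<C> Y \<longleftrightarrow> x \<in> S"
proof -
  have "ident \<C> Y \<in> hom \<C> Y Y"
    by (rule ident_in_hom[OF hom_Obj(1)[OF assms(2)]])
  then have "ident \<C> Y \<in> pullback_sieve \<C> x S \<longleftrightarrow> x \<in> S"
    using compose_ident[OF assms(2)] by (auto simp: in_pullback[OF assms(2)] hom_def)
  then show ?thesis
    using sieve_maximal_iff[OF pullback_is_sieve[OF category_self assms] hom_Obj(1)[OF assms(2)]]
    by simp
qed

lemma topology_superset:
  assumes T: "grothendieck_topology \<C> T" and S: "(X, S) \<in> T" and R: "is_sieve \<C> X R" "S \<subseteq> R"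
  shows "(X, R) \<in> T"
proof (rule topology_transitive[OF T S R(1)])
  fix x assume "x \<in> S"
  then have xR: "x \<in> R" using R(2) by blast
  have x: "x \<in> hom \<C> (source \<C> x) X" by (rule sieve_arrow[OF R(1) xR])
  then show "(source \<C> x, pullback_sieve \<C> x R) \<in> T"
    using pullback_maximal_iff[OF R(1) x] xR topology_maximal[OF T hom_Obj(1)[OF x]] by simp
qed

section \<open>Closed sieves\<close>

lemma closed_sieveD:
  assumes "closed_sieve \<C> T X D" "x \<in> hom \<C> Y X" "(Y, pullback_sieve \<C> x D) \<in> T"
  shows "x \<in> D"
  using assms unfolding closed_sieve_def by blast

lemma maximal_closed: "closed_sieve \<C> T X (maximal_sieve \<C> X)"
  by (auto simp: closed_sieve_def maximal_sieve_def hom_def)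

lemma pullback_closed:
  assumes "closed_sieve \<C> T X D" "x \<in> hom \<C> Y X"
  shows "closed_sieve \<C> T Y (pullback_sieve \<C> x D)"
  unfolding closed_sieve_def
proof (intro allI ballI impI)
  fix Z y
  assume y: "y \<in> hom \<C> Z Y" "(Z, pullback_sieve \<C> y (pullback_sieve \<C> x D)) \<in> T"
  then have "compose \<C> x y \<in> D"
    using closed_sieveD[OF assms(1) compose_in_hom[OF y(1) assms(2)]]
      pullback_compose[OF assms(2) y(1)] by simp
  then show "y \<in> pullback_sieve \<C> x D"
    using y(1) by (auto simp: in_pullback[OF assms(2)] hom_def)
qed

lemma closed_covered_maximal:
  assumes T: "grothendieck_topology \<C> T" and S: "(X, S) \<in> T"
    and D: "is_sieve \<C> X D" "S \<subseteq> D" "closed_sieve \<C> T X D"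
  shows "D = maximal_sieve \<C> X"
proof -
  have X: "X \<in> Obj \<C>" by (rule topology_sieve(1)[OF T S])
  have "(X, pullback_sieve \<C> (ident \<C> X) D) \<in> T"
    using topology_superset[OF T S D(1,2)] pullback_ident[OF D(1) X] by simp
  then have "ident \<C> X \<in> D"
    by (rule closed_sieveD[OF D(3) ident_in_hom[OF X]])
  then show ?thesis
    using sieve_maximal_iff[OF D(1) X] by simp
qed

end

definition closure_sieve ::
    "('o, 'm) cat \<Rightarrow> ('o \<times> 'm set) set \<Rightarrow> 'o \<Rightarrow> 'm set \<Rightarrow> 'm set" where
  "closure_sieve \<C> T X S =
     {x. x \<in> hom \<C> (source \<C> x) X \<and> (source \<C> x, pullback_sieve \<C> x S) \<in> T}"

text \<open>The image of \<open>D\<close> under the right adjoint \<open>\<forall>\<^sub>x\<close> of \<open>x\<^sup>*\<close>.  The base changes of \<open>x\<close> along \<open>u\<close>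
  need not be representable; the pairs \<open>(v, w)\<close> with \<open>u \<circ> v = x \<circ> w\<close> are their generalized elements.\<close>

definition forall_sieve :: "('o, 'm) cat \<Rightarrow> 'o \<Rightarrow> 'o \<Rightarrow> 'm \<Rightarrow> 'm set \<Rightarrow> 'm set" where
  "forall_sieve \<C> Y X x D =
     {u. u \<in> hom \<C> (source \<C> u) X \<and>
       (\<forall>W. \<forall>v\<in>hom \<C> W (source \<C> u). \<forall>w\<in>hom \<C> W Y.
          compose \<C> u v = compose \<C> x w \<longrightarrow> w \<in> D)}"

context category
begin

lemma closure_is_sieve:
  assumes T: "grothendieck_topology \<C> T"
  shows "is_sieve \<C> X (closure_sieve \<C> T X S)"
  unfolding is_sieve_def
proof (intro conjI ballI impI)
  show "closure_sieve \<C> T X S \<subseteq> {x \<in> Arr \<C>. target \<C> x = X}"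
    by (auto simp: closure_sieve_def hom_def)
next
  fix x y
  assume x: "x \<in> closure_sieve \<C> T X S" and "y \<in> Arr \<C>" "target \<C> y = source \<C> x"
  then have y: "y \<in> hom \<C> (source \<C> y) (source \<C> x)" by (simp add: hom_def)
  from x have x1: "x \<in> hom \<C> (source \<C> x) X" "(source \<C> x, pullback_sieve \<C> x S) \<in> T"
    by (auto simp: closure_sieve_def)
  have xy: "compose \<C> x y \<in> hom \<C> (source \<C> y) X"
    by (rule compose_in_hom[OF y x1(1)])
  then have src: "source \<C> (compose \<C> x y) = source \<C> y" by (simp add: hom_def)
  show "compose \<C> x y \<in> closure_sieve \<C> T X S"
    using xy topology_stable[OF T x1(2) y] pullback_compose[OF x1(1) y]
    by (simp add: closure_sieve_def src)
qed

lemma closure_contains: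
  assumes T: "grothendieck_topology \<C> T" and S: "is_sieve \<C> X S"
  shows "S \<subseteq> closure_sieve \<C> T X S"
proof
  fix x assume x: "x \<in> S"
  have h: "x \<in> hom \<C> (source \<C> x) X" by (rule sieve_arrow[OF S x])
  then show "x \<in> closure_sieve \<C> T X S"
    using pullback_maximal_iff[OF S h] x topology_maximal[OF T hom_Obj(1)[OF h]]
    by (simp add: closure_sieve_def)
qed

text \<open>Idempotence of the closure is the transitivity axiom: if the closure of \<open>S\<close> covers along \<open>x\<close>,
  then \<open>S\<close> does.  Passing from \<open>T\<close> to a smaller \<open>J\<close> only weakens what closedness demands.\<close>

lemma closure_sieve_closed:
  assumes T: "grothendieck_topology \<C> T" and J: "J \<subseteq> T" and S: "is_sieve \<C> X S"
  shows "closed_sieve \<C> J X (closure_sieve \<C> T X S)"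
  unfolding closed_sieve_def
proof (intro allI ballI impI)
  fix Y x
  assume x: "x \<in> hom \<C> Y X" and "(Y, pullback_sieve \<C> x (closure_sieve \<C> T X S)) \<in> J"
  then have cov: "(Y, pullback_sieve \<C> x (closure_sieve \<C> T X S)) \<in> T"
    using J by blast
  have "(Y, pullback_sieve \<C> x S) \<in> T"
  proof (rule topology_transitive[OF T cov pullback_is_sieve[OF category_self S x]])
    fix y assume y: "y \<in> pullback_sieve \<C> x (closure_sieve \<C> T X S)"
    then have h: "y \<in> hom \<C> (source \<C> y) Y" and c: "compose \<C> x y \<in> closure_sieve \<C> T X S"
      by (simp_all add: in_pullback[OF x])
    have "source \<C> (compose \<C> x y) = source \<C> y"
      using compose_in_hom[OF h x] by (simp add: hom_def)
    then show "(source \<C> y, pullback_sieve \<C> y (pullback_sieve \<C> x S)) \<in> T"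
      using c pullback_compose[OF x h] by (simp add: closure_sieve_def)
  qed
  then show "x \<in> closure_sieve \<C> T X S"
    using x by (auto simp: closure_sieve_def hom_def)
qed

lemma forall_sieveI:
  assumes "u \<in> hom \<C> Z X"
    and "\<And>W v w. v \<in> hom \<C> W Z \<Longrightarrow> w \<in> hom \<C> W Y \<Longrightarrow> compose \<C> u v = compose \<C> x w \<Longrightarrow> w \<in> D"
  shows "u \<in> forall_sieve \<C> Y X x D"
  using assms by (auto simp: forall_sieve_def hom_def)

lemma forall_sieveD:
  assumes "u \<in> forall_sieve \<C> Y X x D" "u \<in> hom \<C> Z X"
    and "v \<in> hom \<C> W Z" "w \<in> hom \<C> W Y" "compose \<C> u v = compose \<C> x w"
  shows "w \<in> D"
proof -
  have "source \<C> u = Z" using assms(2) by (simp add: hom_def)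
  then show ?thesis using assms unfolding forall_sieve_def by blast
qed

lemma forall_is_sieve: "is_sieve \<C> X (forall_sieve \<C> Y X x D)"
  unfolding is_sieve_def
proof (intro conjI ballI impI)
  show "forall_sieve \<C> Y X x D \<subseteq> {x \<in> Arr \<C>. target \<C> x = X}"
    by (auto simp: forall_sieve_def hom_def)
next
  fix u u'
  assume u: "u \<in> forall_sieve \<C> Y X x D" and "u' \<in> Arr \<C>" "target \<C> u' = source \<C> u"
  then have u': "u' \<in> hom \<C> (source \<C> u') (source \<C> u)" by (simp add: hom_def)
  have h: "u \<in> hom \<C> (source \<C> u) X" using u by (simp add: forall_sieve_def)
  show "compose \<C> u u' \<in> forall_sieve \<C> Y X x D"
  proof (rule forall_sieveI[OF compose_in_hom[OF u' h]])
    fix W v w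
    assume v: "v \<in> hom \<C> W (source \<C> u')" and w: "w \<in> hom \<C> W Y"
      and eq: "compose \<C> (compose \<C> u u') v = compose \<C> x w"
    have "compose \<C> u (compose \<C> u' v) = compose \<C> x w"
      using eq compose_assoc[OF v u' h] by simp
    then show "w \<in> D"
      by (rule forall_sieveD[OF u h compose_in_hom[OF v u'] w])
  qed
qed

lemma forall_sieve_counit:
  assumes x: "x \<in> hom \<C> Y X"
  shows "pullback_sieve \<C> x (forall_sieve \<C> Y X x D) \<subseteq> D"
proof
  fix w assume "w \<in> pullback_sieve \<C> x (forall_sieve \<C> Y X x D)"
  then have w: "w \<in> hom \<C> (source \<C> w) Y" and c: "compose \<C> x w \<in> forall_sieve \<C> Y X x D"
    by (simp_all add: in_pullback[OF x])
  have xw: "compose \<C> x w \<in> hom \<C> (source \<C> w) X" by (rule compose_in_hom[OF w x])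
  show "w \<in> D"
    by (rule forall_sieveD[OF c xw ident_in_hom[OF hom_Obj(1)[OF w]] w compose_ident[OF xw]])
qed

lemma forall_sieve_adjoint:
  assumes x: "x \<in> hom \<C> Y X" and S: "is_sieve \<C> X S" and D: "pullback_sieve \<C> x S \<subseteq> D"
  shows "S \<subseteq> forall_sieve \<C> Y X x D"
proof
  fix u assume u: "u \<in> S"
  have h: "u \<in> hom \<C> (source \<C> u) X" by (rule sieve_arrow[OF S u])
  show "u \<in> forall_sieve \<C> Y X x D"
  proof (rule forall_sieveI[OF h])
    fix W v w
    assume v: "v \<in> hom \<C> W (source \<C> u)" and w: "w \<in> hom \<C> W Y"
      and eq: "compose \<C> u v = compose \<C> x w"
    have "compose \<C> x w \<in> S"
      using sieve_compose[OF S u h v] eq by simp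
    then have "w \<in> pullback_sieve \<C> x S"
      using w by (auto simp: in_pullback[OF x] hom_def)
    then show "w \<in> D" using D by blast
  qed
qed

text \<open>If \<open>\<forall>\<^sub>x D\<close> covers along \<open>u\<close> and \<open>u \<circ> v = x \<circ> w\<close>, then it covers along \<open>x \<circ> w\<close> by
  stability; hence \<open>D\<close>, which contains \<open>x\<^sup>*\<forall>\<^sub>x D\<close>, covers along \<open>w\<close>.\<close>

lemma forall_sieve_closed:
  assumes T: "grothendieck_topology \<C> T" and x: "x \<in> hom \<C> Y X"
    and D: "is_sieve \<C> Y D" "closed_sieve \<C> T Y D"
  shows "closed_sieve \<C> T X (forall_sieve \<C> Y X x D)"
  unfolding closed_sieve_def
proof (intro allI ballI impI)
  let ?A = "forall_sieve \<C> Y X x D"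
  fix Z u
  assume u: "u \<in> hom \<C> Z X" and cov: "(Z, pullback_sieve \<C> u ?A) \<in> T"
  show "u \<in> ?A"
  proof (rule forall_sieveI[OF u])
    fix W v w
    assume v: "v \<in> hom \<C> W Z" and w: "w \<in> hom \<C> W Y"
      and eq: "compose \<C> u v = compose \<C> x w"
    have "pullback_sieve \<C> v (pullback_sieve \<C> u ?A) = pullback_sieve \<C> w (pullback_sieve \<C> x ?A)"
      using pullback_compose[OF u v] pullback_compose[OF x w] eq by simp
    then have covw: "(W, pullback_sieve \<C> w (pullback_sieve \<C> x ?A)) \<in> T"
      using topology_stable[OF T cov v] by simp
    have sub: "pullback_sieve \<C> w (pullback_sieve \<C> x ?A) \<subseteq> pullback_sieve \<C> w D"
      using forall_sieve_counit[OF x] by (auto simp: pullback_sieve_def)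
    have "(W, pullback_sieve \<C> w D) \<in> T"
      by (rule topology_superset[OF T covw pullback_is_sieve[OF category_self D(1) w] sub])
    then show "w \<in> D"
      by (rule closed_sieveD[OF D(2) w])
  qed
qed

end

section \<open>The topology of dense sieves\<close>

definition dense_sieves ::
    "('o, 'm) cat \<Rightarrow> 'k set \<Rightarrow> ('k \<Rightarrow> ('o \<times> 'm set) set) \<Rightarrow> ('o \<times> 'm set) set" where
  "dense_sieves \<C> K J = {(X, S). X \<in> Obj \<C> \<and> is_sieve \<C> X S \<and>
     (\<forall>D. is_sieve \<C> X D \<and> S \<subseteq> D \<and> (\<forall>k\<in>K. closed_sieve \<C> (J k) X D) \<longrightarrow>
        D = maximal_sieve \<C> X)}"

context category
begin

lemma dense_sievesI:
  assumes "X \<in> Obj \<C>" "is_sieve \<C> X S"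
    and "\<And>D. is_sieve \<C> X D \<Longrightarrow> S \<subseteq> D \<Longrightarrow> (\<And>k. k \<in> K \<Longrightarrow> closed_sieve \<C> (J k) X D) \<Longrightarrow>
      D = maximal_sieve \<C> X"
  shows "(X, S) \<in> dense_sieves \<C> K J"
  using assms by (auto simp: dense_sieves_def)

lemma dense_sievesD:
  assumes "(X, S) \<in> dense_sieves \<C> K J"
  shows "X \<in> Obj \<C>" "is_sieve \<C> X S"
    and "is_sieve \<C> X D \<Longrightarrow> S \<subseteq> D \<Longrightarrow> (\<And>k. k \<in> K \<Longrightarrow> closed_sieve \<C> (J k) X D) \<Longrightarrow>
      D = maximal_sieve \<C> X"
  using assms by (auto simp: dense_sieves_def)

lemma dense_stable:
  assumes J: "\<And>k. k \<in> K \<Longrightarrow> grothendieck_topology \<C> (J k)"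
    and S: "(X, S) \<in> dense_sieves \<C> K J" and x: "x \<in> hom \<C> Y X"
  shows "(Y, pullback_sieve \<C> x S) \<in> dense_sieves \<C> K J"
proof (rule dense_sievesI)
  note S' = dense_sievesD(2)[OF S]
  show "Y \<in> Obj \<C>" by (rule hom_Obj(1)[OF x])
  show "is_sieve \<C> Y (pullback_sieve \<C> x S)"
    by (rule pullback_is_sieve[OF category_self S' x])
  fix D
  assume D: "is_sieve \<C> Y D" "pullback_sieve \<C> x S \<subseteq> D"
    and cl: "\<And>k. k \<in> K \<Longrightarrow> closed_sieve \<C> (J k) Y D"
  let ?A = "forall_sieve \<C> Y X x D"
  have "?A = maximal_sieve \<C> X"
    by (rule dense_sievesD(3)[OF S forall_is_sieve forall_sieve_adjoint[OF x S' D(2)]])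
      (rule forall_sieve_closed[OF J x D(1) cl])
  then have "x \<in> ?A" using x by (auto simp: maximal_sieve_def hom_def)
  then have "pullback_sieve \<C> x ?A = maximal_sieve \<C> Y"
    using pullback_maximal_iff[OF forall_is_sieve x] by simp
  then have "maximal_sieve \<C> Y \<subseteq> D"
    using forall_sieve_counit[OF x, of D] by simp
  then show "D = maximal_sieve \<C> Y"
    using D(1) by (auto simp: is_sieve_def maximal_sieve_def)
qed

text \<open>For a closed \<open>D\<close> containing \<open>R\<close>, local density of \<open>R\<close> along \<open>S\<close> makes \<open>x\<^sup>*D\<close> maximal for
  every \<open>x \<in> S\<close>; that is \<open>S \<subseteq> D\<close>, and the density of \<open>S\<close> applies.\<close>

lemma dense_transitive:
  assumes S: "(X, S) \<in> dense_sieves \<C> K J" and R: "is_sieve \<C> X R"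
    and loc: "\<And>x. x \<in> S \<Longrightarrow> (source \<C> x, pullback_sieve \<C> x R) \<in> dense_sieves \<C> K J"
  shows "(X, R) \<in> dense_sieves \<C> K J"
proof (rule dense_sievesI[OF dense_sievesD(1)[OF S] R])
  fix D
  assume D: "is_sieve \<C> X D" "R \<subseteq> D" and cl: "\<And>k. k \<in> K \<Longrightarrow> closed_sieve \<C> (J k) X D"
  have "x \<in> D" if "x \<in> S" for x
  proof -
    have x: "x \<in> hom \<C> (source \<C> x) X"
      by (rule sieve_arrow[OF dense_sievesD(2)[OF S] that])
    have "pullback_sieve \<C> x R \<subseteq> pullback_sieve \<C> x D"
      using D(2) by (auto simp: pullback_sieve_def)
    then have "pullback_sieve \<C> x D = maximal_sieve \<C> (source \<C> x)"
      by (rule dense_sievesD(3)[OF loc[OF that] pullback_is_sieve[OF category_self D(1) x]])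
        (rule pullback_closed[OF cl x])
    then show "x \<in> D" using pullback_maximal_iff[OF D(1) x] by simp
  qed
  then show "D = maximal_sieve \<C> X"
    using dense_sievesD(3)[OF S D(1) _ cl] by blast
qed

lemma dense_topology:
  assumes "\<And>k. k \<in> K \<Longrightarrow> grothendieck_topology \<C> (J k)"
  shows "grothendieck_topology \<C> (dense_sieves \<C> K J)"
  unfolding grothendieck_topology_def
proof (intro conjI allI impI ballI)
  fix p assume "p \<in> dense_sieves \<C> K J"
  then show "case p of (X, S) \<Rightarrow> X \<in> Obj \<C> \<and> is_sieve \<C> X S"
    by (auto simp: dense_sieves_def)
next
  fix X assume "X \<in> Obj \<C>"
  then show "(X, maximal_sieve \<C> X) \<in> dense_sieves \<C> K J"
    by (rule dense_sievesI[OF _ maximal_is_sieve[OF category_self]])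
      (auto simp: is_sieve_def maximal_sieve_def)
next
  fix X S Y x
  assume "(X, S) \<in> dense_sieves \<C> K J" "x \<in> hom \<C> Y X"
  then show "(Y, pullback_sieve \<C> x S) \<in> dense_sieves \<C> K J"
    using dense_stable[where K = K and J = J] assms by blast
next
  fix X S R
  assume "(X, S) \<in> dense_sieves \<C> K J \<and> is_sieve \<C> X R \<and>
    (\<forall>x\<in>S. (source \<C> x, pullback_sieve \<C> x R) \<in> dense_sieves \<C> K J)"
  then show "(X, R) \<in> dense_sieves \<C> K J"
    by (blast intro: dense_transitive)
qed

lemma topology_subset_dense:
  assumes "k \<in> K" and T: "grothendieck_topology \<C> (J k)"
  shows "J k \<subseteq> dense_sieves \<C> K J"
proof clarify
  fix X S assume S: "(X, S) \<in> J k"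
  show "(X, S) \<in> dense_sieves \<C> K J"
  proof (rule dense_sievesI[OF topology_sieve[OF T S]])
    fix D
    assume D: "is_sieve \<C> X D" "S \<subseteq> D" and cl: "\<And>k. k \<in> K \<Longrightarrow> closed_sieve \<C> (J k) X D"
    show "D = maximal_sieve \<C> X"
      by (rule closed_covered_maximal[OF T S D cl[OF assms(1)]])
  qed
qed

lemma dense_imp_covering:
  assumes T: "grothendieck_topology \<C> T" and J: "\<And>k. k \<in> K \<Longrightarrow> J k \<subseteq> T"
    and S: "(X, S) \<in> dense_sieves \<C> K J"
  shows "(X, S) \<in> T"
proof -
  note X = dense_sievesD(1)[OF S] and S' = dense_sievesD(2)[OF S]
  have "closure_sieve \<C> T X S = maximal_sieve \<C> X"
    by (rule dense_sievesD(3)[OF S closure_is_sieve[OF T] closure_contains[OF T S']])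
      (rule closure_sieve_closed[OF T J S'])
  then have "ident \<C> X \<in> closure_sieve \<C> T X S"
    using sieve_maximal_iff[OF closure_is_sieve[OF T] X] by simp
  then show "(X, S) \<in> T"
    using ident_in_hom[OF X] pullback_ident[OF S' X] by (simp add: closure_sieve_def hom_def)
qed

lemma join_eq_dense:
  assumes J: "\<And>k. k \<in> K \<Longrightarrow> grothendieck_topology \<C> (J k)"
  shows "join_topology \<C> K J = dense_sieves \<C> K J"
proof
  show "join_topology \<C> K J \<subseteq> dense_sieves \<C> K J"
  proof (rule join_topology_least(3)[OF category_self])
    show "grothendieck_topology \<C> (dense_sieves \<C> K J)"
      using dense_topology[where K = K and J = J] J by blast
    show "J k \<subseteq> dense_sieves \<C> K J" if "k \<in> K" for k
      using topology_subset_dense[where K = K and J = J] that J by blast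
  qed (rule J)
  have "grothendieck_topology \<C> (join_topology \<C> K J)"
    by (rule join_topology_least(1)[OF category_self J])
  moreover have "J k \<subseteq> join_topology \<C> K J" if "k \<in> K" for k
    by (rule join_topology_least(2)[OF category_self J that])
  ultimately show "dense_sieves \<C> K J \<subseteq> join_topology \<C> K J"
    using dense_imp_covering by (metis subrelI)
qed

end

section \<open>Covering sieves of the join\<close>

theorem mainTheorem10:
  fixes \<C> :: "('o, 'm) cat"
    and K :: "'k set"
    and J :: "'k \<Rightarrow> ('o \<times> 'm set) set"
    and X :: 'o
    and C :: "'m set"
  assumes "category \<C>"
    and "essentially_small TYPE('u) \<C>"
    and "\<And>k. k \<in> K \<Longrightarrow> grothendieck_topology \<C> (J k)"
    and "X \<in> Obj \<C>"
    and "is_sieve \<C> X C"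
  shows "(X, C) \<in> join_topology \<C> K J \<longleftrightarrow>
    {C'. is_sieve \<C> X C' \<and> C \<subseteq> C' \<and> (\<forall>k\<in>K. closed_sieve \<C> (J k) X C')}
      = {maximal_sieve \<C> X}"
proof -
  interpret category \<C> by fact
  let ?A = "{C'. is_sieve \<C> X C' \<and> C \<subseteq> C' \<and> (\<forall>k\<in>K. closed_sieve \<C> (J k) X C')}"
  have "maximal_sieve \<C> X \<in> ?A"
    using maximal_is_sieve[OF category_self] maximal_closed assms(5)
    by (auto simp: is_sieve_def maximal_sieve_def)
  then have "?A = {maximal_sieve \<C> X} \<longleftrightarrow> (\<forall>D\<in>?A. D = maximal_sieve \<C> X)"
    by blast
  also have "\<dots> \<longleftrightarrow> (X, C) \<in> dense_sieves \<C> K J"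
    using assms(4,5) by (auto simp: dense_sieves_def)
  finally show ?thesis
    using join_eq_dense[of K J] assms(3) by simp
qed

end
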